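(* Let $(A,\mu,\alpha)$ be a right Hom-alternative algebra over a field $\mathbf{k}$ of characteristic $0$, and let $\beta\colon A\to A$ be a weak morphism. Then the Hom-algebra $$A_\beta=(A,\ \mu_\beta=\beta\mu,\ \beta\alpha)$$ is also a right Hom-alternative algebra. Moreover, if $(A,\mu,\alpha)$ is multiplicative and $\beta$ is a morphism, then $A_\beta$ is multiplicative.
   Context: We work over a fixed field $\mathbf{k}$ of characteristic $0$. A Hom-algebra is a triple $(A,\mu,\alpha)$ where $A$ is a $\mathbf{k}$-module, $\mu\colon A^{\otimes 2}\to A$ is bilinear (the multiplication, written $xy=\mu(x,y)$), and $\alpha\colon A\to A$ is linear (the twisting map); no compatibility is assumed. It is multiplicative if $\alpha(xy)=\alpha(x)\alpha(y)$ for all $x,y\in A$. The Hom-associator is $as_A(x,y,z)=(xy)\alpha(z)-\alpha(x)(yz)$. $A$ is right Hom-alternative if $as_A(x,y,y)=0$ for all $x,y\in A$. A weak morphism $f\colon A\to B$ of Hom-algebras is a linear map with $f(\mu_A(x,y))=\mu_B(f(x),f(y))$ for all $x,y$; a morphism is a weak morphism that also satisfies $f\alpha_A=\alpha_B f$. Here $\beta\mu$ denotes $(x,y)\mapsto\beta(\mu(x,y))$ and $\beta\alpha$ denotes the composite $x\mapsto\beta(\alpha(x))$. *)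

theory Defs
  imports Complex_Main
begin

text \<open>
  The ground field is a type \<open>'k\<close> of class \<open>field_char_0\<close>. The underlying space of a Hom-algebra is
  a type \<open>'a\<close> together with a scalar multiplication \<open>scale\<close> making it a \<open>'k\<close>-vector space, and
  multiplication is given in curried form, \<open>\<mu> x y\<close>. No compatibility between \<open>\<mu>\<close> and \<open>\<alpha>\<close> is
  assumed.
\<close>

locale hom_algebra = vector_space scale
  for scale :: "'k::field_char_0 \<Rightarrow> 'a::ab_group_add \<Rightarrow> 'a" +
  fixes \<mu> :: "'a \<Rightarrow> 'a \<Rightarrow> 'a"
    and \<alpha> :: "'a \<Rightarrow> 'a"
  assumes linear_mult_right: "Vector_Spaces.linear scale scale (\<lambda>y. \<mu> x y)"
    and linear_mult_left: "Vector_Spaces.linear scale scale (\<lambda>x. \<mu> x y)"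
    and linear_twist: "Vector_Spaces.linear scale scale \<alpha>"

definition hom_associator ::
  "('a::ab_group_add \<Rightarrow> 'a \<Rightarrow> 'a) \<Rightarrow> ('a \<Rightarrow> 'a) \<Rightarrow> 'a \<Rightarrow> 'a \<Rightarrow> 'a \<Rightarrow> 'a"
  where "hom_associator \<mu> \<alpha> x y z = \<mu> (\<mu> x y) (\<alpha> z) - \<mu> (\<alpha> x) (\<mu> y z)"

locale multiplicative_hom_algebra = hom_algebra +
  assumes twist_mult: "\<alpha> (\<mu> x y) = \<mu> (\<alpha> x) (\<alpha> y)"

locale right_hom_alternative_algebra = hom_algebra +
  assumes right_hom_alternative: "hom_associator \<mu> \<alpha> x y y = 0"

locale weak_hom_algebra_morphism =
  A: hom_algebra scale\<^sub>A \<mu>\<^sub>A \<alpha>\<^sub>A + B: hom_algebra scale\<^sub>B \<mu>\<^sub>B \<alpha>\<^sub>B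
  for scale\<^sub>A :: "'k::field_char_0 \<Rightarrow> 'a::ab_group_add \<Rightarrow> 'a" and \<mu>\<^sub>A \<alpha>\<^sub>A
    and scale\<^sub>B :: "'k \<Rightarrow> 'b::ab_group_add \<Rightarrow> 'b" and \<mu>\<^sub>B \<alpha>\<^sub>B +
  fixes f :: "'a \<Rightarrow> 'b"
  assumes linear_morphism: "Vector_Spaces.linear scale\<^sub>A scale\<^sub>B f"
    and morphism_mult: "f (\<mu>\<^sub>A x y) = \<mu>\<^sub>B (f x) (f y)"

locale hom_algebra_morphism = weak_hom_algebra_morphism +
  assumes morphism_twist: "f \<circ> \<alpha>\<^sub>A = \<alpha>\<^sub>B \<circ> f"

end

theory Submission
  imports Defs
begin

text \<open>
  In the Hom-associator of \<open>A\<^sub>\<beta>\<close>, both factors of each outer product carry a \<open>\<beta>\<close>, one coming from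
  the inner product and one from the twisting map. Since \<open>\<beta>\<close> preserves products, these two merge
  into a single \<open>\<beta>\<close> in front of the outer product, which contributes another. By linearity the
  Hom-associator of \<open>A\<^sub>\<beta>\<close> is therefore that of \<open>A\<close> followed by \<open>\<beta> \<circ> \<beta>\<close>
  (\<open>hom_associator_twisted\<close>), so that its vanishing on \<open>(x, y, y)\<close> passes from \<open>A\<close> to \<open>A\<^sub>\<beta>\<close>.

  For multiplicativity, commutation of \<open>\<beta>\<close> with \<open>\<alpha>\<close> makes \<open>\<beta> \<circ> \<alpha>\<close> preserve \<open>\<beta>\<mu>\<close>, not only \<open>\<mu>\<close>.
\<close>

lemma hom_algebra_twisted:
  assumes "weak_hom_algebra_morphism scale \<mu> \<alpha> scale \<mu> \<alpha> \<beta>"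
  shows "hom_algebra scale (\<lambda>x y. \<beta> (\<mu> x y)) (\<beta> \<circ> \<alpha>)"
proof -
  interpret weak_hom_algebra_morphism scale \<mu> \<alpha> scale \<mu> \<alpha> \<beta> by fact
  show ?thesis
  proof (intro hom_algebra.intro hom_algebra_axioms.intro A.vector_space_axioms)
    show "Vector_Spaces.linear scale scale (\<lambda>y. \<beta> (\<mu> x y))" for x
      using Vector_Spaces.linear_compose[OF A.linear_mult_right linear_morphism]
      by (simp add: o_def)
    show "Vector_Spaces.linear scale scale (\<lambda>x. \<beta> (\<mu> x y))" for y
      using Vector_Spaces.linear_compose[OF A.linear_mult_left linear_morphism]
      by (simp add: o_def)
    show "Vector_Spaces.linear scale scale (\<beta> \<circ> \<alpha>)"
      by (rule Vector_Spaces.linear_compose[OF A.linear_twist linear_morphism])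
  qed
qed

lemma hom_associator_twisted:
  assumes "weak_hom_algebra_morphism scale \<mu> \<alpha> scale \<mu> \<alpha> \<beta>"
  shows "hom_associator (\<lambda>x y. \<beta> (\<mu> x y)) (\<beta> \<circ> \<alpha>) x y z = \<beta> (\<beta> (hom_associator \<mu> \<alpha> x y z))"
proof -
  interpret weak_hom_algebra_morphism scale \<mu> \<alpha> scale \<mu> \<alpha> \<beta> by fact
  interpret \<beta>: Vector_Spaces.linear scale scale \<beta> by (rule linear_morphism)
  show ?thesis
    by (simp add: hom_associator_def \<beta>.diff morphism_mult)
qed

lemma right_hom_alternative_algebra_twisted:
  assumes "right_hom_alternative_algebra scale \<mu> \<alpha>"
    and "weak_hom_algebra_morphism scale \<mu> \<alpha> scale \<mu> \<alpha> \<beta>"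
  shows "right_hom_alternative_algebra scale (\<lambda>x y. \<beta> (\<mu> x y)) (\<beta> \<circ> \<alpha>)"
proof -
  interpret right_hom_alternative_algebra scale \<mu> \<alpha> by fact
  interpret weak_hom_algebra_morphism scale \<mu> \<alpha> scale \<mu> \<alpha> \<beta> by fact
  interpret \<beta>: Vector_Spaces.linear scale scale \<beta> by (rule linear_morphism)
  interpret twisted: hom_algebra scale "\<lambda>x y. \<beta> (\<mu> x y)" "\<beta> \<circ> \<alpha>"
    by (rule hom_algebra_twisted) fact
  show ?thesis
    by unfold_locales
      (simp only: hom_associator_twisted[OF assms(2)] right_hom_alternative \<beta>.zero)
qed

text \<open>
  Both sides of the required identity equal \<open>\<beta>\<^sup>2(\<alpha>(x) \<alpha>(y))\<close>: on the left \<open>\<alpha>\<close> is first moved past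
  the inner \<open>\<beta>\<close>, after which multiplicativity of \<open>\<alpha>\<close> applies.
\<close>

lemma multiplicative_hom_algebra_twisted:
  assumes "multiplicative_hom_algebra scale \<mu> \<alpha>"
    and "hom_algebra_morphism scale \<mu> \<alpha> scale \<mu> \<alpha> \<beta>"
  shows "multiplicative_hom_algebra scale (\<lambda>x y. \<beta> (\<mu> x y)) (\<beta> \<circ> \<alpha>)"
proof -
  interpret multiplicative_hom_algebra scale \<mu> \<alpha> by fact
  interpret hom_algebra_morphism scale \<mu> \<alpha> scale \<mu> \<alpha> \<beta> by fact
  interpret twisted: hom_algebra scale "\<lambda>x y. \<beta> (\<mu> x y)" "\<beta> \<circ> \<alpha>"
    by (rule hom_algebra_twisted) unfold_locales
  have "\<alpha> (\<beta> x) = \<beta> (\<alpha> x)" for x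
    using morphism_twist by (metis comp_apply)
  then show ?thesis
    by unfold_locales (simp add: twist_mult morphism_mult)
qed

theorem theorem2p6:
  fixes scale :: "'k::field_char_0 \<Rightarrow> 'a::ab_group_add \<Rightarrow> 'a"
    and \<mu> :: "'a \<Rightarrow> 'a \<Rightarrow> 'a"
    and \<alpha> \<beta> :: "'a \<Rightarrow> 'a"
  assumes "right_hom_alternative_algebra scale \<mu> \<alpha>"
    and "weak_hom_algebra_morphism scale \<mu> \<alpha> scale \<mu> \<alpha> \<beta>"
  shows "right_hom_alternative_algebra scale (\<lambda>x y. \<beta> (\<mu> x y)) (\<beta> \<circ> \<alpha>)
    \<and> (multiplicative_hom_algebra scale \<mu> \<alpha> \<and> hom_algebra_morphism scale \<mu> \<alpha> scale \<mu> \<alpha> \<beta>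
        \<longrightarrow> multiplicative_hom_algebra scale (\<lambda>x y. \<beta> (\<mu> x y)) (\<beta> \<circ> \<alpha>))"
  using right_hom_alternative_algebra_twisted[OF assms] multiplicative_hom_algebra_twisted
  by blast

end
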